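(* For all real $a>0$, $b$ with $|b|<\pi$, and all $t\in\mathbb{R}$, \begin{align*} \int_{\mathbb{R}\setminus\{0\}}(e^{itx}-1-itx)&\,\frac{1}{4a}\,e^{bx/a}\,\frac{e^{\pi x/a}(\pi-b)+e^{-\pi x/a}(b+\pi)}{\sinh^2(\pi x/a)}\,dx \\ &= -i\,\frac{at}{2}\tan(b/2) -\frac{at}{2}\tanh\Big(\frac{at-ib}{2}\Big)\\ &= -i\,\frac{at}{2}\tan(b/2)- \frac{at}{2}\,\frac{\sinh(at)-i\sin(b)}{\cosh(at)+\cos(b)}\\ &= - \frac{at}{2}\,\frac{\sinh(at)}{\cosh(at)+\cos(b)} - i \,\frac{at}{2}\Big(\tan(b/2) -\frac{\sin(b)}{\cosh(at)+\cos(b)}\Big). \end{align*}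
   Context: (The identity is associated with the selfdecomposable Meixner distribution $\mathbb{M}(a,b,1/2,0)$, whose characteristic function is $\cos(b/2)/\cosh\big(\frac{at-ib}{2}\big)$.) *)

theory Defs
  imports "HOL-Analysis.Analysis"
begin

(* Levy density of the background driving variable of the Meixner law M(a,b,1/2,0).
   The totalized division puts the value 0 at x = 0; that point is removed from the
   domain of integration. *)
definition meixner_bdlp_density :: "real \<Rightarrow> real \<Rightarrow> real \<Rightarrow> real" where
  "meixner_bdlp_density a b x =
     1 / (4 * a) * exp (b * x / a) *
     ((exp (pi * x / a) * (pi - b) + exp (- (pi * x / a)) * (b + pi)) / (sinh (pi * x / a))\<^sup>2)"

end

theory Submission
  imports Defs "HOL-Probability.Characteristic_Functions" "HOL-Real_Asymp.Real_Asymp"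
begin

text \<open>
For \<open>x > 0\<close> the density is \<open>- h' x\<close>, where \<open>h x = exp (b x / a) / (2 sinh (\<pi> x / a))\<close>. Expanding
\<open>1 / sinh\<close> in a geometric series turns \<open>h\<close> into a sum of decaying exponentials, so the density
is the sum of the exponential densities \<open>\<lambda>\<^sub>n exp (- \<lambda>\<^sub>n x)\<close> with the rates
\<open>\<lambda>\<^sub>n = (2 \<pi> / a) (n + 1/2 - b / (2 \<pi>))\<close> (\<open>meixner_bdlp_density_sums\<close>). These rates are positive because
\<open>b < \<pi>\<close>. Against \<open>exp (i t x) - 1 - i t x\<close>, a single term integrates to \<open>i t (1 / (\<lambda> - i t) - 1 / \<lambda>)\<close>,
and since \<open>\<bar>exp (i t x) - 1 - i t x\<bar> \<le> (t x)\<^sup>2 / 2\<close>, the integral of its modulus is at most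
\<open>t\<^sup>2 / \<lambda>\<^sup>2\<close>. The squares \<open>1 / \<lambda>\<^sub>n\<^sup>2\<close> are summable, so the series may be integrated
term by term, which also gives absolute integrability. The resulting sum of
differences of reciprocals of an arithmetic progression is a difference of two values of the
digamma function (\<open>meixner_half_line_integral\<close>).

The reflection \<open>x \<mapsto> - x\<close> exchanges \<open>(b, t)\<close> with \<open>(- b, - t)\<close> and so settles the negative
half-line. In the sum of the two contributions the digamma values pair up as
\<open>\<psi> (1/2 + w) - \<psi> (1/2 - w) = \<pi> tan (\<pi> w)\<close> (\<open>Digamma_half_reflection\<close>, the logarithmic derivative
of the reflection formula for \<open>\<Gamma>\<close>), at \<open>\<pi> w = (b + i a t) / 2\<close> and at \<open>\<pi> w = b / 2\<close>. The first tangent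
is \<open>i tanh ((a t - i b) / 2)\<close>. The other two forms follow by splitting this hyperbolic
tangent into its real and imaginary parts.
\<close>

section \<open>The digamma function\<close>

text \<open>
Differentiating \<open>\<Gamma> z \<Gamma> (1 - z) = \<pi> / sin (\<pi> z)\<close> at \<open>z = 1/2 - w\<close> gives
\<open>\<psi> (1 - z) - \<psi> z = \<pi> cot (\<pi> z)\<close>, and the shift by \<open>1/2\<close> turns the cotangent into a tangent. The
bound on \<open>Re w\<close> keeps \<open>z\<close> away from the integers.
\<close>

lemma Digamma_half_reflection:
  fixes w :: complex
  assumes "\<bar>Re w\<bar> < 1 / 2"
  shows "Digamma (1 / 2 + w) - Digamma (1 / 2 - w) = of_real pi * tan (of_real pi * w)"
proof -
  define z where "z = 1 / 2 - w"
  define s where "s = sin (of_real pi * z)"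
  define c where "c = cos (of_real pi * z)"
  have Rez: "0 < Re z" "Re z < 1"
    using assms by (auto simp: z_def)
  have nz: "z \<notin> \<int>" and nz': "1 - z \<notin> \<int>"
    using Rez by (auto elim!: Ints_cases)
  have np: "z \<notin> \<int>\<^sub>\<le>\<^sub>0" "1 - z \<notin> \<int>\<^sub>\<le>\<^sub>0"
    using nz nz' by (auto dest: nonpos_Ints_Int)
  have s0: "s \<noteq> 0"
    using nz unfolding s_def by (auto simp: sin_eq_0 mult_ac)
  have G0: "Gamma z * Gamma (1 - z) = of_real pi / s"
    using Gamma_reflection_complex[of z] by (simp add: s_def)
  have "((\<lambda>z. Gamma z * Gamma (1 - z)) has_field_derivative
          Gamma z * Gamma (1 - z) * (Digamma z - Digamma (1 - z))) (at z)"
    using np by (auto intro!: derivative_eq_intros simp: algebra_simps)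
  moreover have "((\<lambda>z. Gamma z * Gamma (1 - z)) has_field_derivative
          - (of_real pi)\<^sup>2 * c / s\<^sup>2) (at z)"
    unfolding Gamma_reflection_complex
    using s0 by (auto intro!: derivative_eq_intros simp: s_def c_def power2_eq_square)
  ultimately have "of_real pi / s * (Digamma z - Digamma (1 - z)) = - (of_real pi)\<^sup>2 * c / s\<^sup>2"
    unfolding G0 by (rule DERIV_unique)
  also have "\<dots> = - (of_real pi / s * (of_real pi * (c / s)))"
    by (simp add: power2_eq_square)
  finally have "of_real pi / s * (Digamma (1 - z) - Digamma z) = of_real pi / s * (of_real pi * (c / s))"
    by (simp only: minus_diff_eq[symmetric, of "Digamma z"] mult_minus_right neg_equal_iff_equal)
  then have "Digamma (1 - z) - Digamma z = of_real pi * (c / s)"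
    unfolding mult_cancel_left using s0 by simp
  moreover have "of_real pi * z = of_real pi / 2 - of_real pi * w"
    by (simp add: z_def algebra_simps)
  hence "c = sin (of_real pi * w)" "s = cos (of_real pi * w)"
    by (simp_all add: c_def s_def cos_diff sin_diff)
  ultimately show ?thesis
    by (simp add: z_def tan_def add.commute algebra_simps)
qed

text \<open>
Subtracting the defining series at two points cancels Euler's constant and the terms
\<open>1 / (n + 1)\<close> that make each of them converge.
\<close>

lemma Digamma_diff_sums:
  fixes p q :: complex
  assumes "p \<noteq> 0" "q \<noteq> 0"
  shows "(\<lambda>n. inverse (q + of_nat n) - inverse (p + of_nat n)) sums (Digamma p - Digamma q)"
  using sums_diff[OF summable_sums[OF summable_Digamma[OF assms(1)]]
                     summable_sums[OF summable_Digamma[OF assms(2)]]]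
  by (simp add: Digamma_def)

section \<open>Compensated exponentials against an exponential density\<close>

text \<open>
The function \<open>- (x\<^sup>2 + 2 x / l + 2 / l\<^sup>2) exp (- l x)\<close> is an antiderivative. This second moment
dominates the integrands below, because the compensated exponential vanishes to second order at
the origin.
\<close>

lemma second_moment_exponential:
  fixes l :: real
  assumes "l > 0"
  shows "set_integrable lborel {0<..} (\<lambda>x. x\<^sup>2 * (l * exp (- l * x)))"
    and "(LBINT x:{0<..}. x\<^sup>2 * (l * exp (- l * x))) = 2 / l\<^sup>2"
proof -
  define F where "F = (\<lambda>x. - (x\<^sup>2 + 2 * x / l + 2 / l\<^sup>2) * exp (- l * x))"
  have D: "DERIV F x :> x\<^sup>2 * (l * exp (- l * x))" for x
    unfolding F_def using assms
    by (auto intro!: derivative_eq_intros simp: field_simps power2_eq_square)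
  have "(F \<longlongrightarrow> - (2 / l\<^sup>2)) (at_right 0)"
    unfolding F_def using assms by (auto intro!: tendsto_eq_intros)
  then have 0: "((F \<circ> real_of_ereal) \<longlongrightarrow> - (2 / l\<^sup>2)) (at_right 0)"
    by (simp add: zero_ereal_def ereal_tendsto_simps1)
  have "(F \<longlongrightarrow> 0) at_top"
    unfolding F_def using assms by real_asymp
  then have 1: "((F \<circ> real_of_ereal) \<longlongrightarrow> 0) (at_left \<infinity>)"
    by (simp add: ereal_tendsto_simps1)
  note FTC = interval_integral_FTC_nonneg[of 0 \<infinity> F "\<lambda>x. x\<^sup>2 * (l * exp (- l * x))", OF _ D _ _ 0 1]
  have ei: "einterval 0 \<infinity> = {0<..}" by (auto simp: einterval_def zero_ereal_def)
  show "set_integrable lborel {0<..} (\<lambda>x. x\<^sup>2 * (l * exp (- l * x)))"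
    using FTC(1) assms by (simp add: ei)
  show "(LBINT x:{0<..}. x\<^sup>2 * (l * exp (- l * x))) = 2 / l\<^sup>2"
    using FTC(2) assms by (simp add: interval_lebesgue_integral_0_infty)
qed

definition compensated_exp :: "real \<Rightarrow> real \<Rightarrow> complex" where
  "compensated_exp t x = exp (\<i> * of_real (t * x)) - 1 - \<i> * of_real (t * x)"

lemma norm_compensated_exp_le: "norm (compensated_exp t x) \<le> t\<^sup>2 / 2 * x\<^sup>2"
  using iexp_approx1[of "t * x" 1]
  by (simp add: compensated_exp_def eval_nat_numeral power_mult_distrib algebra_simps)

lemma compensated_exp_measurable [measurable]: "compensated_exp t \<in> borel_measurable borel"
  unfolding compensated_exp_def[abs_def] by measurable

lemma norm_compensated_exp_exponential_le:
  "l > 0 \<Longrightarrow> norm (compensated_exp t x * of_real (l * exp (- l * x)))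
     \<le> t\<^sup>2 / 2 * (x\<^sup>2 * (l * exp (- l * x)))"
  using mult_right_mono[OF norm_compensated_exp_le[of t x], of "l * exp (- l * x)"]
  by (simp add: norm_mult mult_ac)

lemma compensated_exp_exponential_integrable:
  assumes "l > 0"
  shows "set_integrable lborel {0<..} (\<lambda>x. compensated_exp t x * of_real (l * exp (- l * x)))"
proof (rule set_integrable_bound)
  show "set_integrable lborel {0<..} (\<lambda>x. t\<^sup>2 / 2 * (x\<^sup>2 * (l * exp (- l * x))))"
    using second_moment_exponential(1)[OF assms] by (rule set_integrable_mult_right)
  show "set_borel_measurable lborel {0<..} (\<lambda>x. compensated_exp t x * of_real (l * exp (- l * x)))"
    unfolding set_borel_measurable_def by measurable
  show "AE x in lborel. x \<in> {0<..} \<longrightarrow> norm (compensated_exp t x * of_real (l * exp (- l * x)))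
          \<le> norm (t\<^sup>2 / 2 * (x\<^sup>2 * (l * exp (- l * x))))"
    using norm_compensated_exp_exponential_le[OF assms] assms
    by (intro AE_I2) (auto simp: abs_mult)
qed

lemma norm_compensated_exp_exponential_integral_le:
  assumes "l > 0"
  shows "(LBINT x:{0<..}. norm (compensated_exp t x * of_real (l * exp (- l * x)))) \<le> t\<^sup>2 / l\<^sup>2"
proof -
  have "(LBINT x:{0<..}. norm (compensated_exp t x * of_real (l * exp (- l * x))))
      \<le> (LBINT x:{0<..}. t\<^sup>2 / 2 * (x\<^sup>2 * (l * exp (- l * x))))"
    by (intro set_integral_mono set_integrable_norm compensated_exp_exponential_integrable assms
        set_integrable_mult_right second_moment_exponential norm_compensated_exp_exponential_le)
  also have "\<dots> = t\<^sup>2 / l\<^sup>2"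
    using second_moment_exponential(2)[OF assms] by simp
  finally show ?thesis .
qed

text \<open>
The integral comes from an explicit antiderivative: \<open>l / d * exp (d x)\<close> with \<open>d = i t - l\<close> for the
oscillating part, and \<open>- exp (- l x) (1 + i t x + i t / l)\<close> for
\<open>l exp (- l x) (1 + i t x)\<close>.
\<close>

lemma compensated_exp_exponential_integral:
  assumes "l > 0"
  shows "(CLINT x:{0<..}|lborel. compensated_exp t x * of_real (l * exp (- l * x)))
       = \<i> * of_real t * (inverse (of_real l - \<i> * of_real t) - inverse (of_real l))"
proof -
  define d where "d = \<i> * of_real t - (of_real l :: complex)"
  have "Re d \<noteq> 0" using assms by (simp add: d_def)
  then have d0: "d \<noteq> 0" by auto
  have it: "\<i> * of_real t = d + of_real l" by (simp add: d_def)
  define G :: "real \<Rightarrow> complex" where "G = (\<lambda>x. of_real l / d * exp (d * of_real x)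
     + of_real (exp (- l * x)) * (1 + \<i> * of_real t * of_real x + \<i> * of_real t / of_real l))"
  have e: "exp (\<i> * of_real (t * x)) * of_real (exp (- l * x)) = exp (d * of_real x)" for x
    by (simp add: exp_of_real[symmetric] exp_add[symmetric] d_def algebra_simps)
  have D: "(G has_vector_derivative compensated_exp t x * of_real (l * exp (- l * x))) (at x)" for x
  proof -
    have "(G has_vector_derivative of_real l * exp (d * of_real x)
       - of_real l * of_real (exp (- l * x)) * (1 + \<i> * of_real t * of_real x)) (at x)"
      unfolding G_def using d0 assms
      by (auto intro!: derivative_eq_intros has_vector_derivative_real_field simp: algebra_simps)
    then show ?thesis
      unfolding e[symmetric] compensated_exp_def by (simp add: algebra_simps)
  qed
  have "(G \<longlongrightarrow> of_real l / d + 1 + \<i> * of_real t / of_real l) (at_right 0)"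
    unfolding G_def by (rule tendsto_eq_intros refl | simp)+
  then have 0: "((G \<circ> real_of_ereal) \<longlongrightarrow> of_real l / d + 1 + \<i> * of_real t / of_real l) (at_right 0)"
    by (simp add: zero_ereal_def ereal_tendsto_simps1)
  have "((\<lambda>x. norm (G x)) \<longlongrightarrow> 0) at_top"
  proof (rule Lim_null_comparison)
    let ?B = "\<lambda>x. exp (- l * x) * (l / norm d + 1 + \<bar>t\<bar> * x + \<bar>t\<bar> / l)"
    show "\<forall>\<^sub>F x in at_top. norm (norm (G x)) \<le> ?B x"
      using eventually_gt_at_top[of 0]
    proof eventually_elim
      case (elim x)
      have "norm (G x) \<le> norm (of_real l / d * exp (d * of_real x)) +
        norm (of_real (exp (- l * x)) * (1 + \<i> * of_real t * of_real x + \<i> * of_real t / of_real l))"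
        unfolding G_def by (rule norm_triangle_ineq)
      also have "norm (of_real l / d * exp (d * of_real x)) = l / norm d * exp (- l * x)"
        using assms by (simp add: norm_mult norm_divide d_def)
      also have "norm (of_real (exp (- l * x)) * (1 + \<i> * of_real t * of_real x + \<i> * of_real t / of_real l))
        \<le> exp (- l * x) * (1 + \<bar>t\<bar> * x + \<bar>t\<bar> / l)"
        unfolding norm_mult using elim assms
        by (intro mult_mono order_trans[OF norm_triangle_ineq] add_mono)
           (auto simp: norm_mult norm_divide)
      finally show ?case by (simp add: algebra_simps)
    qed
    show "(?B \<longlongrightarrow> 0) at_top" using assms by real_asymp
  qed
  then have 1: "((G \<circ> real_of_ereal) \<longlongrightarrow> 0) (at_left \<infinity>)"
    by (simp add: ereal_tendsto_simps1 tendsto_norm_zero_iff)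
  have ei: "einterval 0 \<infinity> = {0<..}" by (auto simp: einterval_def zero_ereal_def)
  have "(LBINT x=0..\<infinity>. compensated_exp t x * of_real (l * exp (- l * x)))
      = 0 - (of_real l / d + 1 + \<i> * of_real t / of_real l)"
  proof (rule interval_integral_FTC_integrable[OF _ D _ _ 0 1])
    show "isCont (\<lambda>x. compensated_exp t x * of_real (l * exp (- l * x))) x" for x
      unfolding compensated_exp_def by (intro continuous_intros)
    show "set_integrable lborel (einterval 0 \<infinity>) (\<lambda>x. compensated_exp t x * of_real (l * exp (- l * x)))"
      unfolding ei by (rule compensated_exp_exponential_integrable[OF assms])
  qed simp
  also have "\<dots> = \<i> * of_real t * (inverse (of_real l - \<i> * of_real t) - inverse (of_real l))"
    unfolding it using d0 assms by (simp add: field_simps)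
  finally show ?thesis by (simp add: interval_lebesgue_integral_0_infty)
qed

section \<open>The density as a mixture of exponential densities\<close>

text \<open>
Writing \<open>p + n = (n + 1) + (p - 1)\<close> splits the series into the derivative of the geometric series in
\<open>q = exp (- c x)\<close> and a multiple of the geometric series itself.
\<close>

lemma sums_exponential_mixture:
  fixes c p x :: real
  assumes "c > 0" "x > 0"
  defines "q \<equiv> exp (- c * x)"
  shows "(\<lambda>n. c * (p + real n) * exp (- (c * (p + real n)) * x)) sums
           (c * exp (- c * p * x) * (1 / (1 - q)\<^sup>2 + (p - 1) / (1 - q)))"
proof -
  have q: "norm q < 1" using assms by simp
  have "(\<lambda>n. c * exp (- c * p * x) * (of_nat (Suc n) * q ^ n + (p - 1) * q ^ n)) sums
     (c * exp (- c * p * x) * (1 / (1 - q)\<^sup>2 + (p - 1) * (1 / (1 - q))))"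
    by (intro sums_mult sums_add geometric_deriv_sums geometric_sums q)
  moreover have "c * exp (- c * p * x) * (of_nat (Suc n) * q ^ n + (p - 1) * q ^ n)
      = c * (p + real n) * exp (- (c * (p + real n)) * x)" for n
  proof -
    have "exp (- c * p * x) * q ^ n = exp (- (c * (p + real n)) * x)"
      by (simp add: q_def exp_of_nat_mult[symmetric] exp_add[symmetric] algebra_simps)
    moreover have "c * exp (- c * p * x) * (of_nat (Suc n) * q ^ n + (p - 1) * q ^ n)
        = c * (p + real n) * (exp (- c * p * x) * q ^ n)"
      by (simp add: algebra_simps)
    ultimately show ?thesis by (simp only:)
  qed
  ultimately show ?thesis by (simp only: mult_1_right times_divide_eq_right)
qed

text \<open>
With \<open>E = exp (\<pi> x / a)\<close> and \<open>B = exp (b x / a)\<close>, both the density and the sum of the series are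
rational in \<open>E\<close> and proportional to \<open>B\<close>; the common form is
\<open>B / (a E) * (2 \<pi> - (\<pi> + b) (1 - q)) / (1 - q)\<^sup>2\<close> with \<open>q = 1 / E\<^sup>2\<close>.
\<close>

lemma meixner_bdlp_density_sums:
  fixes a b x :: real
  assumes "a > 0" "x > 0"
  defines "p \<equiv> 1 / 2 - b / (2 * pi)"
  shows "(\<lambda>n. 2 * pi / a * (p + real n) * exp (- (2 * pi / a * (p + real n)) * x))
           sums meixner_bdlp_density a b x"
proof -
  define E where "E = exp (pi * x / a)"
  define B where "B = exp (b * x / a)"
  define q where "q = exp (- (2 * pi / a) * x)"
  have E: "E > 1" using assms by (simp add: E_def)
  have q: "q = 1 / E\<^sup>2"
    by (simp add: q_def E_def exp_minus exp_of_nat_mult[symmetric] inverse_eq_divide mult_ac)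
  have BE: "exp (- (2 * pi / a) * p * x) = B / E"
    using assms by (simp add: B_def E_def exp_diff[symmetric] p_def field_simps)
  have p: "2 * pi * (p - 1) = - pi - b" by (simp add: p_def field_simps)
  have E2: "E\<^sup>2 - 1 \<noteq> 0" using E by (simp add: power2_eq_1_iff)
  have exp_minus_E: "exp (- (pi * x / a)) = 1 / E"
    by (simp add: E_def exp_minus inverse_eq_divide)
  have sinh_E: "sinh (pi * x / a) = (E - 1 / E) / 2"
    by (simp add: sinh_field_def E_def exp_minus inverse_eq_divide)
  have "meixner_bdlp_density a b x = 1 / (4 * a) * B * ((E * (pi - b) + (b + pi) / E) / ((E - 1 / E) / 2)\<^sup>2)"
    unfolding meixner_bdlp_density_def sinh_E exp_minus_E
    unfolding E_def[symmetric] B_def[symmetric] by simp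
  also have "\<dots> = B / (a * E) * ((2 * pi + (- pi - b) * (1 - q)) / (1 - q)\<^sup>2)"
  proof -
    have 1: "(E - 1 / E) / 2 = (E\<^sup>2 - 1) / (2 * E)" "1 - q = (E\<^sup>2 - 1) / E\<^sup>2"
      using E by (simp_all add: field_simps power2_eq_square q)
    define N where "N = E\<^sup>2 * (pi - b) + (b + pi)"
    have 2: "E * (pi - b) + (b + pi) / E = N / E" "2 * pi + (- pi - b) * ((E\<^sup>2 - 1) / E\<^sup>2) = N / E\<^sup>2"
      using E by (simp_all add: N_def field_simps power2_eq_square)
    have "1 / (4 * a) * B * ((N / E) / (D / (2 * E))\<^sup>2) = B / (a * E) * ((N / E\<^sup>2) / (D / E\<^sup>2)\<^sup>2)"
      if "D \<noteq> 0" for D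
      using that E by (simp add: field_simps power2_eq_square)
    then show ?thesis unfolding 1 2 using E2 .
  qed
  also have "\<dots> = 2 * pi / a * exp (- (2 * pi / a) * p * x) * (1 / (1 - q)\<^sup>2 + (p - 1) / (1 - q))"
  proof -
    have "1 - q \<noteq> 0" using E E2 by (simp add: q field_simps)
    moreover have "B / (a * E) * ((2 * pi + 2 * pi * (p - 1) * r) / r\<^sup>2)
        = 2 * pi / a * (B / E) * (1 / r\<^sup>2 + (p - 1) / r)" if "r \<noteq> 0" for r
      using that by (simp add: field_simps power2_eq_square)
    ultimately show ?thesis unfolding BE p[symmetric] by blast
  qed
  finally show ?thesis
    using sums_exponential_mixture[of "2 * pi / a" x p] assms by (simp add: q_def)
qed

lemma meixner_bdlp_density_minus: "meixner_bdlp_density a b (- x) = meixner_bdlp_density a (- b) x"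
  by (simp add: meixner_bdlp_density_def add.commute)

section \<open>The integral over the two half-lines\<close>

text \<open>
Term-by-term integration of the exponential mixture. The bound \<open>t\<^sup>2 / \<lambda>\<^sub>n\<^sup>2\<close> for the integrals
of the moduli decays like \<open>1 / n\<^sup>2\<close>, which justifies the exchange of sum and integral.
Multiplying the rates \<open>2 \<pi> / a * (p + n)\<close> by \<open>a / (2 \<pi>)\<close> gives the unit-step progressions from
\<open>P\<close> and, after the shift by \<open>- i t\<close>, from \<open>Q\<close>, whose reciprocals sum to digamma values.
\<close>

lemma meixner_half_line_integral:
  fixes a b t :: real
  assumes a: "a > 0" and b: "b < pi"
  shows "has_bochner_integral lborel
     (\<lambda>x. indicator {0<..} x *\<^sub>R (compensated_exp t x * of_real (meixner_bdlp_density a b x)))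
     (\<i> * of_real (a * t) / of_real (2 * pi) *
       (Digamma (1 / 2 - of_real b / of_real (2 * pi)) -
        Digamma (1 / 2 - (of_real b + \<i> * of_real (a * t)) / of_real (2 * pi))))"
proof -
  define p where "p = 1 / 2 - b / (2 * pi)"
  define l where "l n = 2 * pi / a * (p + real n)" for n
  define P :: complex where "P = of_real p"
  define Q :: complex where "Q = P - \<i> * of_real (a * t) / of_real (2 * pi)"
  define f where "f n x = indicator {0<..} x *\<^sub>R (compensated_exp t x * of_real (l n * exp (- l n * x)))"
    for n x
  have p: "p > 0" using b by (simp add: p_def)
  have l: "l n > 0" for n using p a by (simp add: l_def add_pos_nonneg)
  have int: "integrable lborel (f n)" for n
    using compensated_exp_exponential_integrable[OF l, of t n] by (simp add: f_def[abs_def] set_integrable_def)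
  have sm: "summable (\<lambda>n. norm (f n x))" for x
  proof (cases "x > 0")
    case True
    have "summable (\<lambda>n. norm (compensated_exp t x) * (l n * exp (- l n * x)))"
      using meixner_bdlp_density_sums[OF a True, of b]
      by (intro summable_mult) (auto simp: sums_iff l_def p_def)
    then show ?thesis using True less_imp_le[OF l] by (simp add: f_def norm_mult abs_mult)
  qed (simp add: f_def)
  have "summable (\<lambda>n. norm (\<integral>x. norm (f n x) \<partial>lborel))"
  proof (rule summable_comparison_test')
    have "summable (\<lambda>n. inverse ((p + real n)\<^sup>2))"
      using p by (intro Polygamma_converges') auto
    then show "summable (\<lambda>n. t\<^sup>2 * (a / (2 * pi))\<^sup>2 * inverse ((p + real n)\<^sup>2))"
      by (rule summable_mult)
    fix n
    have "(\<integral>x. norm (f n x) \<partial>lborel)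
        = (LBINT x:{0<..}. norm (compensated_exp t x * of_real (l n * exp (- l n * x))))"
      unfolding f_def set_lebesgue_integral_def by (intro Bochner_Integration.integral_cong) auto
    also have "\<dots> \<le> t\<^sup>2 / (l n)\<^sup>2"
      by (rule norm_compensated_exp_exponential_integral_le[OF l])
    also have "\<dots> = t\<^sup>2 * (a / (2 * pi))\<^sup>2 * inverse ((p + real n)\<^sup>2)"
      using a by (simp add: l_def power_mult_distrib power_divide inverse_eq_divide)
    finally show "norm (norm (\<integral>x. norm (f n x) \<partial>lborel)) \<le> t\<^sup>2 * (a / (2 * pi))\<^sup>2 * inverse ((p + real n)\<^sup>2)"
      by simp
  qed
  then have sI: "summable (\<lambda>n. \<integral>x. norm (f n x) \<partial>lborel)" by simp
  have lim: "(\<Sum>n. f n x) = indicator {0<..} x *\<^sub>R (compensated_exp t x * of_real (meixner_bdlp_density a b x))" for x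
  proof (cases "x > 0")
    case True
    have "(\<lambda>n. compensated_exp t x * of_real (l n * exp (- l n * x))) sums
        (compensated_exp t x * of_real (meixner_bdlp_density a b x))"
      using meixner_bdlp_density_sums[OF a True, of b]
      by (intro sums_mult sums_of_real) (simp add: l_def p_def)
    then show ?thesis using True by (simp add: f_def sums_iff)
  qed (simp add: f_def)
  have val: "integral\<^sup>L lborel (f n) = \<i> * of_real (a * t) / of_real (2 * pi) *
      (inverse (Q + of_nat n) - inverse (P + of_nat n))" for n
  proof -
    have "integral\<^sup>L lborel (f n) =
       \<i> * of_real t * (inverse (of_real (l n) - \<i> * of_real t) - inverse (of_real (l n)))"
      using compensated_exp_exponential_integral[OF l, of t n]
      by (simp add: f_def[abs_def] set_lebesgue_integral_def)
    also have "of_real (l n) - \<i> * of_real t = of_real (2 * pi) / of_real a * (Q + of_nat n)"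
      using a by (simp add: l_def Q_def P_def field_simps)
    also have "of_real (l n) = of_real (2 * pi) / of_real a * (P + of_nat n)"
      by (simp add: l_def P_def)
    finally show ?thesis
      unfolding inverse_mult_distrib inverse_divide of_real_mult right_diff_distrib[symmetric]
      by (simp only: mult.assoc times_divide_eq_left times_divide_eq_right mult.left_commute)
  qed
  have PQ: "P \<noteq> 0" "Q \<noteq> 0"
    using p by (auto simp: P_def Q_def complex_eq_iff)
  have *: "Digamma P - Digamma Q =
       Digamma (1 / 2 - of_real b / of_real (2 * pi)) -
        Digamma (1 / 2 - (of_real b + \<i> * of_real (a * t)) / of_real (2 * pi))"
    by (simp add: P_def Q_def p_def add_divide_distrib algebra_simps)
  have "(\<lambda>n. integral\<^sup>L lborel (f n)) sums
      (\<i> * of_real (a * t) / of_real (2 * pi) * (Digamma P - Digamma Q))"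
    unfolding val by (intro sums_mult Digamma_diff_sums PQ)
  moreover have "(\<lambda>n. integral\<^sup>L lborel (f n)) sums (\<integral>x. (\<Sum>n. f n x) \<partial>lborel)"
    using int sm sI by (intro sums_integral) auto
  moreover have "integrable lborel (\<lambda>x. \<Sum>n. f n x)"
    using int sm sI by (intro integrable_suminf) auto
  ultimately show ?thesis
    unfolding lim * by (auto simp: has_bochner_integral_iff dest: sums_unique2)
qed

text \<open>
The reflected negative half-line carries the half-line integral with \<open>(- b, - t)\<close>. It enters
with the opposite prefactor and with digamma values at \<open>1/2 + w\<close>, so each of the two points
\<open>w\<close> contributes one instance of the digamma reflection formula.
\<close>

lemma meixner_whole_line_integral:
  fixes a b t :: real
  assumes a: "a > 0" and b: "\<bar>b\<bar> < pi"
  shows "has_bochner_integral lborel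
     (\<lambda>x. indicator (UNIV - {0}) x *\<^sub>R (compensated_exp t x * of_real (meixner_bdlp_density a b x)))
     (\<i> * of_real (a * t) / 2 * (tan ((of_real b + \<i> * of_real (a * t)) / 2) - tan (of_real b / 2)))"
proof -
  define \<beta> :: complex where "\<beta> = of_real b / of_real (2 * pi)"
  define \<zeta> :: complex where "\<zeta> = (of_real b + \<i> * of_real (a * t)) / of_real (2 * pi)"
  define k :: complex where "k = \<i> * of_real (a * t) / of_real (2 * pi)"
  let ?f = "\<lambda>x. compensated_exp t x * of_real (meixner_bdlp_density a b x)"
  have pos: "has_bochner_integral lborel (\<lambda>x. indicator {0<..} x *\<^sub>R ?f x)
     (k * (Digamma (1 / 2 - \<beta>) - Digamma (1 / 2 - \<zeta>)))"
    using meixner_half_line_integral[of a b t] a b by (simp add: k_def \<beta>_def \<zeta>_def)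
  have neg0: "has_bochner_integral lborel
      (\<lambda>x. indicator {0<..} x *\<^sub>R (compensated_exp (- t) x * of_real (meixner_bdlp_density a (- b) x)))
     (- k * (Digamma (1 / 2 + \<beta>) - Digamma (1 / 2 + \<zeta>)))"
  proof -
    have "1 / 2 - of_real (- b) / of_real (2 * pi) = 1 / 2 + \<beta>"
      "1 / 2 - (of_real (- b) + \<i> * of_real (a * - t)) / of_real (2 * pi) = 1 / 2 + \<zeta>"
      "\<i> * of_real (a * - t) / of_real (2 * pi) = - k"
      by (simp_all add: \<beta>_def \<zeta>_def k_def field_simps)
    moreover have "- b < pi" using b by simp
    ultimately show ?thesis using meixner_half_line_integral[OF a, of "- b" "- t"] by (simp only:)
  qed
  have neg: "has_bochner_integral lborel (\<lambda>x. indicator {..<0} x *\<^sub>R ?f x)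
     (- k * (Digamma (1 / 2 + \<beta>) - Digamma (1 / 2 + \<zeta>)))"
  proof -
    have "indicator {..<0} (0 + - 1 * x) *\<^sub>R ?f (0 + - 1 * x) =
      indicator {0<..} x *\<^sub>R (compensated_exp (- t) x * of_real (meixner_bdlp_density a (- b) x))" for x :: real
      by (auto simp: indicator_def compensated_exp_def meixner_bdlp_density_minus)
    with neg0 show ?thesis
      by (subst lborel_has_bochner_integral_real_affine_iff[where c = "-1" and t = 0]) simp_all
  qed
  have "Re \<beta> = b / (2 * pi)" "Re \<zeta> = b / (2 * pi)"
    unfolding \<beta>_def \<zeta>_def Re_divide_of_real by simp_all
  then have R: "\<bar>Re \<beta>\<bar> < 1 / 2" "\<bar>Re \<zeta>\<bar> < 1 / 2"
    using b by (simp_all add: abs_divide)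
  have arg: "of_real pi * \<beta> = of_real b / 2" "of_real pi * \<zeta> = (of_real b + \<i> * of_real (a * t)) / 2"
    by (simp_all add: \<beta>_def \<zeta>_def)
  have "k * (Digamma (1 / 2 - \<beta>) - Digamma (1 / 2 - \<zeta>)) +
        - k * (Digamma (1 / 2 + \<beta>) - Digamma (1 / 2 + \<zeta>))
      = k * ((Digamma (1 / 2 + \<zeta>) - Digamma (1 / 2 - \<zeta>)) - (Digamma (1 / 2 + \<beta>) - Digamma (1 / 2 - \<beta>)))"
    by (simp add: algebra_simps)
  also have "\<dots> = k * of_real pi * (tan ((of_real b + \<i> * of_real (a * t)) / 2) - tan (of_real b / 2))"
    unfolding Digamma_half_reflection[OF R(1)] Digamma_half_reflection[OF R(2)] arg
    by (simp add: algebra_simps)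
  also have "k * of_real pi = \<i> * of_real (a * t) / 2"
    by (simp add: k_def)
  finally have val: "k * (Digamma (1 / 2 - \<beta>) - Digamma (1 / 2 - \<zeta>)) +
        - k * (Digamma (1 / 2 + \<beta>) - Digamma (1 / 2 + \<zeta>)) = 
      \<i> * of_real (a * t) / 2 * (tan ((of_real b + \<i> * of_real (a * t)) / 2) - tan (of_real b / 2))" .
  have "indicator {0<..} x *\<^sub>R ?f x + indicator {..<0} x *\<^sub>R ?f x = indicator (UNIV - {0}) x *\<^sub>R ?f x" for x
    by (auto simp: indicator_def)
  with has_bochner_integral_add[OF pos neg] show ?thesis
    unfolding val by simp
qed

section \<open>Real and imaginary parts of the hyperbolic tangent\<close>

lemma of_real_sinh: "of_real (sinh x) = (sinh (of_real x) :: 'a :: {banach, real_normed_field})"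
  by (simp add: sinh_field_def exp_of_real flip: of_real_minus)

lemma of_real_cosh: "of_real (cosh x) = (cosh (of_real x) :: 'a :: {banach, real_normed_field})"
  by (simp add: cosh_field_def exp_of_real flip: of_real_minus)

text \<open>
Multiplying numerator and denominator of \<open>sinh A / cosh A\<close> by \<open>2 cosh B\<close>, where \<open>B\<close> is the
complex conjugate of \<open>A\<close>, makes the denominator real; the product formulas then reduce
everything to \<open>A + B = x\<close> and \<open>A - B = - i y\<close>.
\<close>

lemma tanh_half_complex:
  fixes x y :: real
  assumes "cosh x + cos y \<noteq> 0"
  shows "tanh ((of_real x - \<i> * of_real y) / 2)
     = (of_real (sinh x) - \<i> * of_real (sin y)) / of_real (cosh x + cos y)"
proof -
  define A :: complex where "A = (of_real x - \<i> * of_real y) / 2"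
  define B :: complex where "B = (of_real x + \<i> * of_real y) / 2"
  have sum: "A + B = of_real x" and diff: "A - B = - (\<i> * of_real y)"
    by (simp_all add: A_def B_def field_simps)
  have N: "2 * sinh A * cosh B = of_real (sinh x) - \<i> * of_real (sin y)"
  proof -
    have "2 * sinh A * cosh B = sinh (A + B) + sinh (A - B)"
      by (simp add: sinh_add sinh_diff)
    then show ?thesis
      unfolding sum diff sinh_minus of_real_sinh sin_of_real[symmetric] sin_conv_sinh by simp
  qed
  have D: "2 * cosh A * cosh B = of_real (cosh x + cos y)"
  proof -
    have "2 * cosh A * cosh B = cosh (A + B) + cosh (A - B)"
      by (simp add: cosh_add cosh_diff)
    then show ?thesis
      unfolding sum diff cosh_minus of_real_add of_real_cosh cos_of_real[symmetric] cos_conv_cosh by simp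
  qed
  have "2 * cosh A * cosh B \<noteq> 0"
    unfolding D of_real_eq_0_iff by (rule assms)
  then have "tanh A = (2 * sinh A * cosh B) / (2 * cosh A * cosh B)"
    by (simp add: tanh_def)
  then show ?thesis
    unfolding N D by (simp add: A_def)
qed

section \<open>The Levy exponent of the background driving law\<close>

theorem corollary5:
  fixes a b t :: real
  assumes "a > 0" and "\<bar>b\<bar> < pi"
  shows "set_integrable lborel (UNIV - {0})
           (\<lambda>x. (exp (\<i> * of_real (t * x)) - 1 - \<i> * of_real (t * x)) *
                of_real (meixner_bdlp_density a b x))
    \<and> (CLINT x:UNIV - {0}|lborel.
           (exp (\<i> * of_real (t * x)) - 1 - \<i> * of_real (t * x)) *
           of_real (meixner_bdlp_density a b x))
      = - \<i> * of_real (a * t / 2 * tan (b / 2))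
        - of_real (a * t / 2) * tanh ((of_real (a * t) - \<i> * of_real b) / 2)
    \<and> - \<i> * of_real (a * t / 2 * tan (b / 2))
        - of_real (a * t / 2) * tanh ((of_real (a * t) - \<i> * of_real b) / 2)
      = - \<i> * of_real (a * t / 2 * tan (b / 2))
        - of_real (a * t / 2) *
          ((of_real (sinh (a * t)) - \<i> * of_real (sin b)) / of_real (cosh (a * t) + cos b))
    \<and> - \<i> * of_real (a * t / 2 * tan (b / 2))
        - of_real (a * t / 2) *
          ((of_real (sinh (a * t)) - \<i> * of_real (sin b)) / of_real (cosh (a * t) + cos b))
      = - of_real (a * t / 2 * (sinh (a * t) / (cosh (a * t) + cos b)))
        - \<i> * of_real (a * t / 2 * (tan (b / 2) - sin b / (cosh (a * t) + cos b)))"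
proof (intro conjI)
  let ?f = "\<lambda>x. (exp (\<i> * of_real (t * x)) - 1 - \<i> * of_real (t * x)) *
                of_real (meixner_bdlp_density a b x) :: complex"
  have int: "has_bochner_integral lborel (\<lambda>x. indicator (UNIV - {0}) x *\<^sub>R ?f x)
     (\<i> * of_real (a * t) / 2 * (tan ((of_real b + \<i> * of_real (a * t)) / 2) - tan (of_real b / 2)))"
    using meixner_whole_line_integral[OF assms, of t] by (simp only: compensated_exp_def)
  from int show "set_integrable lborel (UNIV - {0}) ?f"
    by (simp only: set_integrable_def has_bochner_integral_iff)
  have "(of_real b + \<i> * of_real (a * t)) / 2 = \<i> * ((of_real (a * t) - \<i> * of_real b) / 2)"
    by (simp add: algebra_simps)
  then have "tan ((of_real b + \<i> * of_real (a * t)) / 2) = \<i> * tanh ((of_real (a * t) - \<i> * of_real b) / 2)"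
    by (simp only: tanh_conv_tan mult_minus_left mult_minus_right mult.assoc[symmetric]
        i_squared minus_minus mult_1_left)
  moreover have "tan (of_real b / 2 :: complex) = of_real (tan (b / 2))"
    using tan_of_real[of "b / 2", where ?'a = complex] by simp
  moreover have "(CLINT x:UNIV - {0}|lborel. ?f x) =
      \<i> * of_real (a * t) / 2 * (tan ((of_real b + \<i> * of_real (a * t)) / 2) - tan (of_real b / 2))"
    using int by (simp only: set_lebesgue_integral_def has_bochner_integral_iff)
  ultimately have "(CLINT x:UNIV - {0}|lborel. ?f x) = \<i> * of_real (a * t) / 2 *
      (\<i> * tanh ((of_real (a * t) - \<i> * of_real b) / 2) - of_real (tan (b / 2)))"
    by (simp only:)
  also have "\<dots> = - \<i> * of_real (a * t / 2 * tan (b / 2))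
        - of_real (a * t / 2) * tanh ((of_real (a * t) - \<i> * of_real b) / 2)"
  proof -
    have "\<i> * A / 2 * (\<i> * T - V) = - \<i> * (A / 2 * V) - A / 2 * T" for A T V :: complex
      by (simp add: field_simps)
    from this[of "of_real (a * t)"] show ?thesis
      by (simp only: of_real_mult of_real_divide of_real_numeral)
  qed
  finally show "(CLINT x:UNIV - {0}|lborel. ?f x) = \<dots>" .
  \<comment> \<open>The denominator is positive: \<open>cosh\<close> is at least \<open>1\<close>, and \<open>1 + cos b = 2 cos\<^sup>2 (b / 2)\<close>.\<close>
  have "b / 2 < pi / 2" "- (pi / 2) < b / 2"
    using assms(2) by auto
  then have "cos (b / 2) \<noteq> 0"
    using cos_gt_zero_pi[of "b / 2"] by simp
  then have "0 < 2 * (cos (b / 2))\<^sup>2" by simp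
  also have "\<dots> = 1 + cos b"
    using cos_double_cos[of "b / 2"] by simp
  finally have "0 < cosh (a * t) + cos b"
    using cosh_real_ge_1[of "a * t"] by linarith
  then have "cosh (a * t) + cos b \<noteq> 0" by simp
  from tanh_half_complex[OF this]
  show "- \<i> * of_real (a * t / 2 * tan (b / 2))
        - of_real (a * t / 2) * tanh ((of_real (a * t) - \<i> * of_real b) / 2)
      = - \<i> * of_real (a * t / 2 * tan (b / 2))
        - of_real (a * t / 2) *
          ((of_real (sinh (a * t)) - \<i> * of_real (sin b)) / of_real (cosh (a * t) + cos b))"
    by simp
  show "- \<i> * of_real (a * t / 2 * tan (b / 2))
        - of_real (a * t / 2) *
          ((of_real (sinh (a * t)) - \<i> * of_real (sin b)) / of_real (cosh (a * t) + cos b))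
      = - of_real (a * t / 2 * (sinh (a * t) / (cosh (a * t) + cos b)))
        - \<i> * of_real (a * t / 2 * (tan (b / 2) - sin b / (cosh (a * t) + cos b)))"
  proof -
    have "- \<i> * (A * V) - A * ((S - \<i> * U) / C) = - (A * (S / C)) - \<i> * (A * (V - U / C))"
      for A V S U C :: complex
      by (simp add: diff_divide_distrib right_diff_distrib mult.left_commute)
    then show ?thesis
      by (simp only: of_real_mult of_real_divide of_real_diff)
  qed
qed

end
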